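(* Let $d \ge 2$ be a fixed integer. For each $n$, let $\mathcal{LP}(n,d)$ and $\mathcal{UP}(n,d)$ be the collections of lower perfect and of upper perfect subsets of $\mathcal{M}_{n,d}$, respectively, and let $\mathcal{I}(n,d)$ be the collection of squarefree monomial ideals of $\Bbbk[x_1,\dots,x_n]$ minimally generated by exactly $\frac12\binom{n}{d}$ monomials of degree $d$, where each such ideal is identified with its set of minimal generators, i.e. with a subset of $\mathcal{M}_{n,d}$ of cardinality $\frac12\binom nd$. Then $$\lim_{n \to \infty} \frac{\#\left(\mathcal{LP}(n,d)\cap\mathcal{I}(n,d)\right)}{\#\mathcal{I}(n,d)} = 1 \quad\text{and}\quad \lim_{n \to \infty} \frac{\#\left(\mathcal{UP}(n,d)\cap\mathcal{I}(n,d)\right)}{\#\mathcal{I}(n,d)} = 0,$$ where the limits are taken over those $n \ge d$ for which $\binom{n}{d}$ is even (so that $\mathcal{I}(n,d)\neq\emptyset$).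
   Context: $\Bbbk$ is a field and $\mathcal{M}_{n,d}$ denotes the set of squarefree monomials of degree $d$ in $\Bbbk[x_1,\dots,x_n]$. A subset $\mathcal{A} \subseteq \mathcal{M}_{n,d}$ is upper perfect if $\{f x_i \mid f \in \mathcal{A},\ x_i \nmid f,\ 1 \le i \le n\} = \mathcal{M}_{n,d+1}$. It is lower perfect if $\{g/x_i \mid g \in \mathcal{A},\ x_i \mid g,\ 1 \le i \le n\} = \mathcal{M}_{n,d-1}$. *)

theory Defs
  imports Complex_Main "HOL-Library.Poly_Mapping" "HOL-Algebra.Ideal"
begin

text \<open>
  Polynomials in countably many variables are finitely supported functions from exponent vectors
  \<^typ>\<open>nat \<Rightarrow>\<^sub>0 nat\<close> to coefficients, with the ring structure of the library; \<open>poly_ring n\<close> is the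
  subring of polynomials in which only the variables with indices \<open>1, \<dots>, n\<close> occur, that is,
  $\Bbbk[x_1,\dots,x_n]$. It is packaged as a ring record in order to use the library's ideals.
\<close>

type_synonym 'k mpoly = "(nat \<Rightarrow>\<^sub>0 nat) \<Rightarrow>\<^sub>0 'k"

definition monomial :: "(nat \<Rightarrow>\<^sub>0 nat) \<Rightarrow> 'k::field mpoly" where
  "monomial m = Poly_Mapping.single m 1"

definition var :: "nat \<Rightarrow> 'k::field mpoly" where
  "var i = monomial (Poly_Mapping.single i 1)"

definition poly_ring :: "nat \<Rightarrow> 'k::field mpoly ring" where
  "poly_ring n =
     \<lparr>carrier = {p. \<forall>m\<in>Poly_Mapping.keys p. Poly_Mapping.keys m \<subseteq> {1..n}},
      mult = (*), one = 1, zero = 0, add = (+)\<rparr>"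

definition monomials :: "nat \<Rightarrow> 'k::field mpoly set" where
  "monomials n = {monomial m | m. Poly_Mapping.keys m \<subseteq> {1..n}}"

definition squarefree_monomials :: "nat \<Rightarrow> 'k::field mpoly set" where
  "squarefree_monomials n =
     {monomial m | m. Poly_Mapping.keys m \<subseteq> {1..n} \<and> (\<forall>i. Poly_Mapping.lookup m i \<le> 1)}"

definition squarefree_monomials_deg :: "nat \<Rightarrow> nat \<Rightarrow> 'k::field mpoly set" where
  "squarefree_monomials_deg n d =
     {monomial m | m. Poly_Mapping.keys m \<subseteq> {1..n} \<and> (\<forall>i. Poly_Mapping.lookup m i \<le> 1) \<and>
                      (\<Sum>i\<in>{1..n}. Poly_Mapping.lookup m i) = d}"

definition upper_perfect :: "nat \<Rightarrow> nat \<Rightarrow> 'k::field mpoly set \<Rightarrow> bool" where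
  "upper_perfect n d A \<longleftrightarrow>
     {f * var i | f i. f \<in> A \<and> i \<in> {1..n} \<and> \<not> var i dvd f} = squarefree_monomials_deg n (d + 1)"

text \<open>
  In \<open>lower_perfect\<close>, the set of all quotients $g/x_i$ with $g \in A$ and $x_i \mid g$ is written as
  the set of all \<open>h\<close> with \<open>h * var i = g\<close>; the quotient is unique since the ring is a domain.
\<close>

definition lower_perfect :: "nat \<Rightarrow> nat \<Rightarrow> 'k::field mpoly set \<Rightarrow> bool" where
  "lower_perfect n d A \<longleftrightarrow>
     {h. \<exists>g\<in>A. \<exists>i\<in>{1..n}. h * var i = g} = squarefree_monomials_deg n (d - 1)"

definition UP :: "nat \<Rightarrow> nat \<Rightarrow> 'k::field mpoly set set" where
  "UP n d = {A. A \<subseteq> squarefree_monomials_deg n d \<and> upper_perfect n d A}"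

definition LP :: "nat \<Rightarrow> nat \<Rightarrow> 'k::field mpoly set set" where
  "LP n d = {A. A \<subseteq> squarefree_monomials_deg n d \<and> lower_perfect n d A}"

definition squarefree_monomial_ideal :: "nat \<Rightarrow> 'k::field mpoly set \<Rightarrow> bool" where
  "squarefree_monomial_ideal n J \<longleftrightarrow>
     (\<exists>S. S \<subseteq> squarefree_monomials n \<and> J = Idl\<^bsub>poly_ring n\<^esub> S)"

definition minimally_generates :: "nat \<Rightarrow> 'k::field mpoly set \<Rightarrow> 'k mpoly set \<Rightarrow> bool" where
  "minimally_generates n G J \<longleftrightarrow>
     Idl\<^bsub>poly_ring n\<^esub> G = J \<and> (\<forall>H. H \<subset> G \<longrightarrow> Idl\<^bsub>poly_ring n\<^esub> H \<noteq> J)"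

text \<open>
  Every monomial ideal has exactly one minimal generating set consisting of monomials, so the
  description below is meaningful for every squarefree monomial ideal.
\<close>

definition min_gens :: "nat \<Rightarrow> 'k::field mpoly set \<Rightarrow> 'k mpoly set" where
  "min_gens n J = (THE G. G \<subseteq> monomials n \<and> minimally_generates n G J)"

definition half_ideals :: "nat \<Rightarrow> nat \<Rightarrow> 'k::field mpoly set set" where
  "half_ideals n d =
     {J. squarefree_monomial_ideal n J \<and>
         min_gens n J \<subseteq> squarefree_monomials_deg n d \<and>
         2 * card (min_gens n J) = n choose d}"

text \<open>
  The same collection, with each ideal identified with its set of minimal generators. On
  \<^const>\<open>half_ideals\<close> the map \<^term>\<open>min_gens n\<close> is injective, as an ideal is generated by its minimal
  generators.
\<close>

definition half_gens :: "nat \<Rightarrow> nat \<Rightarrow> 'k::field mpoly set set" where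
  "half_gens n d = min_gens n ` half_ideals n d"

definition even_binomial_filter :: "nat \<Rightarrow> nat filter" where
  "even_binomial_filter d = inf sequentially (principal {n. d \<le> n \<and> even (n choose d)})"

end

theory Submission
  imports Defs "HOL-Library.Disjoint_Sets" "HOL-Real_Asymp.Real_Asymp"
begin

text \<open>
  An ideal generated by a set \<open>A\<close> of monomials of one common degree has \<open>A\<close> as its minimal monomial
  generating set, since no monomial of that degree divides another. So \<^term>\<open>half_gens n d\<close> consists of
  \<^emph>\<open>all\<close> subsets of the $2h = \binom nd$ squarefree monomials of degree \<open>d\<close> that have exactly \<open>h\<close>
  elements (\<open>half_gens_eq\<close>), and the two limits are statements about a uniformly random such subset.

  Identify squarefree monomials with subsets of \<open>{1..n}\<close>. Then \<open>A\<close> is lower perfect iff for every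
  \<open>(d-1)\<close>-set \<open>S\<close> it meets the set of all \<open>d\<close>-sets that contain \<open>S\<close>, and it is upper perfect iff for every
  \<open>(d+1)\<close>-set \<open>T\<close> it meets the set of all \<open>d\<close>-sets that are contained in \<open>T\<close>. A random half misses a
  given \<open>k\<close>-set with probability
  $$p_k = \binom{2h-k}{h} \Big/ \binom{2h}{h}, \qquad\text{and}\qquad
    3^{-k} \le p_k \le 2^{-k},$$
  where the lower bound holds for \<open>2k \<le> h\<close>. The two properties differ in the size of the sets to be met.

  \<^item> For lower perfection, each set has the growing size \<open>n - (d - 1)\<close>, and there are only polynomially
    many of them in \<open>n\<close>. By the union bound (\<open>card_missing_some\<close>) some set is missed with probability at most
    $\binom{n}{d-1} 2^{-(n-d+1)} \to 0$.

  \<^item> For upper perfection, each set has the fixed size \<open>d + 1\<close>. Cutting \<open>{1..n}\<close> into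
    \<open>m = n div (d + 1)\<close> disjoint blocks of size \<open>d + 1\<close> gives \<open>m\<close> pairwise disjoint sets, and the events
    of missing them are pairwise nonpositively correlated. By Chebyshev's inequality for the number of
    missed sets (\<open>card_hitting_disjoint_family\<close>), all of them are met with probability at most
    $1 / (m\,p_{d+1}) \le 3^{d+1} / m \to 0$.
\<close>

section \<open>Minimal generators of equigenerated monomial ideals\<close>

lemma carrier_poly_ring:
  "carrier (poly_ring n) = {p. \<forall>m\<in>Poly_Mapping.keys p. Poly_Mapping.keys m \<subseteq> {1..n}}"
  by (simp add: poly_ring_def)

lemma keys_add_exponents:
  fixes a b :: "nat \<Rightarrow>\<^sub>0 nat"
  shows "Poly_Mapping.keys (a + b) = Poly_Mapping.keys a \<union> Poly_Mapping.keys b"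
  by (auto simp: lookup_add in_keys_iff)

lemma ring_poly_ring: "ring (poly_ring n :: 'k::field mpoly ring)"
proof (rule ringI)
  show "abelian_group (poly_ring n :: 'k mpoly ring)"
  proof (rule abelian_groupI)
    fix x y :: "'k mpoly"
    assume "x \<in> carrier (poly_ring n)" "y \<in> carrier (poly_ring n)"
    then show "x \<oplus>\<^bsub>poly_ring n\<^esub> y \<in> carrier (poly_ring n)"
      using Poly_Mapping.keys_add[of x y] unfolding carrier_poly_ring
      by (auto simp: poly_ring_def)
  next
    fix x :: "'k mpoly"
    assume "x \<in> carrier (poly_ring n)"
    then show "\<exists>y\<in>carrier (poly_ring n). y \<oplus>\<^bsub>poly_ring n\<^esub> x = \<zero>\<^bsub>poly_ring n\<^esub>"
      by (intro bexI[of _ "- x"]) (auto simp: poly_ring_def)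
  qed (auto simp: poly_ring_def ac_simps)
  show "monoid (poly_ring n :: 'k mpoly ring)"
  proof (rule monoidI)
    fix x y :: "'k mpoly"
    assume "x \<in> carrier (poly_ring n)" "y \<in> carrier (poly_ring n)"
    then show "x \<otimes>\<^bsub>poly_ring n\<^esub> y \<in> carrier (poly_ring n)"
      using Poly_Mapping.keys_mult[of x y] unfolding carrier_poly_ring
      by (fastforce simp: poly_ring_def keys_add_exponents)
  qed (auto simp: poly_ring_def ac_simps)
qed (auto simp: poly_ring_def algebra_simps)

text \<open>
  The polynomials all of whose monomials are multiples of elements of \<open>S\<close> form an ideal containing \<open>S\<close>.
\<close>
lemma monomial_in_generated_ideal_imp_multiple:
  fixes m :: "nat \<Rightarrow>\<^sub>0 nat"
  assumes S: "S \<subseteq> monomials n"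
    and m: "monomial m \<in> Idl\<^bsub>poly_ring n\<^esub> (S :: 'k::field mpoly set)"
  shows "\<exists>s t. monomial s \<in> S \<and> m = s + t"
proof -
  define I :: "'k mpoly set" where
    "I = {p \<in> carrier (poly_ring n). \<forall>m\<in>Poly_Mapping.keys p. \<exists>s t. monomial s \<in> S \<and> m = s + t}"
  interpret ring "poly_ring n :: 'k mpoly ring" by (rule ring_poly_ring)
  have mult_I: "x * a \<in> I" if "a \<in> I" "x \<in> carrier (poly_ring n)" for a x
  proof -
    have "x * a \<in> carrier (poly_ring n)"
      using m_closed[of x a] that by (simp add: I_def poly_ring_def)
    moreover have "\<exists>s t. monomial s \<in> S \<and> k = s + t" if k: "k \<in> Poly_Mapping.keys (x * a)" for k
    proof -
      obtain u v where uv: "k = u + v" "v \<in> Poly_Mapping.keys a"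
        using Poly_Mapping.keys_mult[of x a] k by auto
      then obtain s t where "monomial s \<in> S" "v = s + t"
        using \<open>a \<in> I\<close> unfolding I_def by blast
      with uv have "monomial s \<in> S \<and> k = s + (u + t)"
        by (simp add: ac_simps)
      then show ?thesis by blast
    qed
    ultimately show ?thesis by (simp add: I_def)
  qed
  have "ideal I (poly_ring n)"
  proof (rule idealI)
    show "subgroup I (add_monoid (poly_ring n))"
    proof (rule add.subgroupI)
      show "I \<noteq> {}"
        by (auto simp: I_def poly_ring_def intro!: exI[of _ 0])
    next
      fix a assume "a \<in> I"
      moreover have "- 1 \<in> carrier (poly_ring n :: 'k mpoly ring)"
        by (auto simp: poly_ring_def)
      ultimately have "- a \<in> I"
        using mult_I[of a "- 1"] by simp
      moreover have "\<ominus>\<^bsub>poly_ring n\<^esub> a = - a"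
      proof (rule minus_equality)
        show "- a \<oplus>\<^bsub>poly_ring n\<^esub> a = \<zero>\<^bsub>poly_ring n\<^esub>" by (simp add: poly_ring_def)
      qed (use \<open>a \<in> I\<close> \<open>- a \<in> I\<close> in \<open>auto simp: I_def\<close>)
      ultimately show "\<ominus>\<^bsub>poly_ring n\<^esub> a \<in> I" by simp
    next
      fix a b assume "a \<in> I" "b \<in> I"
      then show "a \<oplus>\<^bsub>poly_ring n\<^esub> b \<in> I"
        using Poly_Mapping.keys_add[of a b] a_closed[of a b]
        by (auto simp: I_def) (auto simp: poly_ring_def)
    qed (auto simp: I_def)
  next
    fix a x :: "'k mpoly"
    assume ax: "a \<in> I" "x \<in> carrier (poly_ring n)"
    show "x \<otimes>\<^bsub>poly_ring n\<^esub> a \<in> I" "a \<otimes>\<^bsub>poly_ring n\<^esub> x \<in> I"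
      using mult_I[OF ax] by (simp_all add: poly_ring_def mult.commute)
  qed (rule ring_poly_ring)
  moreover have "S \<subseteq> I"
  proof
    fix p assume p: "p \<in> S"
    then obtain k where k: "p = monomial k" "Poly_Mapping.keys k \<subseteq> {1..n}"
      using S by (auto simp: monomials_def)
    have "\<exists>s t. monomial s \<in> S \<and> k = s + t"
      using p k(1) by (intro exI[of _ k] exI[of _ 0]) auto
    then show "p \<in> I"
      using k by (auto simp: I_def carrier_poly_ring monomial_def)
  qed
  ultimately have "monomial m \<in> I"
    using genideal_minimal m by blast
  then show ?thesis
    by (auto simp: I_def monomial_def)
qed

lemma squarefree_monomials_deg_subset_monomials:
  "squarefree_monomials_deg n d \<subseteq> monomials n"
  by (auto simp: squarefree_monomials_deg_def monomials_def)

lemma monomial_eq_iff: "(monomial s :: 'k::field mpoly) = monomial t \<longleftrightarrow> s = t"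
  unfolding monomial_def by (metis keys_single singleton_inject zero_neq_one)

lemma squarefree_monomials_deg_antichain:
  assumes "(monomial s :: 'k::field mpoly) \<in> squarefree_monomials_deg n d"
    and "(monomial (s + t) :: 'k mpoly) \<in> squarefree_monomials_deg n d"
  shows "t = 0"
proof -
  from assms have "(\<Sum>i\<in>{1..n}. Poly_Mapping.lookup t i) = 0"
    and "Poly_Mapping.keys t \<subseteq> {1..n}"
    by (auto simp: squarefree_monomials_deg_def monomial_eq_iff lookup_add sum.distrib
        keys_add_exponents)
  then show ?thesis
    by (intro poly_mapping_eqI) (metis finite_atLeastAtMost in_keys_iff lookup_zero subsetD sum_eq_0_iff)
qed

text \<open>
  Monomials of equal degree do not properly divide each other, so a set of monomials that generates
  the same ideal as \<open>A\<close> has to contain \<open>A\<close>. This gives the minimality of \<open>A\<close> as well as the uniqueness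
  on which the definite description in \<^const>\<open>min_gens\<close> depends.
\<close>
lemma min_gens_Idl:
  fixes A :: "'k::field mpoly set"
  assumes A: "A \<subseteq> squarefree_monomials_deg n d"
  shows "min_gens n (Idl\<^bsub>poly_ring n\<^esub> A) = A"
proof -
  interpret ring "poly_ring n :: 'k mpoly ring" by (rule ring_poly_ring)
  have Amon: "A \<subseteq> monomials n"
    using A squarefree_monomials_deg_subset_monomials by blast
  \<comment> \<open>Every \<open>a \<in> A\<close> is a multiple of some \<open>g \<in> G\<close>, which in turn is a multiple of some \<open>b \<in> A\<close>;
      comparing degrees, \<open>a = g = b\<close>.\<close>
  have A_sub: "A \<subseteq> G"
    if G: "G \<subseteq> monomials n" and eq: "Idl\<^bsub>poly_ring n\<^esub> G = Idl\<^bsub>poly_ring n\<^esub> A" for G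
  proof
    fix a assume a: "a \<in> A"
    then obtain m where m: "a = monomial m" using Amon by (auto simp: monomials_def)
    have "a \<in> Idl\<^bsub>poly_ring n\<^esub> G" using a eq unfolding genideal_def by blast
    then obtain g t where g: "monomial g \<in> G" "m = g + t"
      using monomial_in_generated_ideal_imp_multiple[OF G] m by blast
    have "monomial g \<in> Idl\<^bsub>poly_ring n\<^esub> A" using g eq unfolding genideal_def by blast
    then obtain b u where b: "monomial b \<in> A" "g = b + u"
      using monomial_in_generated_ideal_imp_multiple[OF Amon] by blast
    have "u + t = 0"
      by (rule squarefree_monomials_deg_antichain[of b n d "u + t", where 'k = 'k])
        (use A a b g m in \<open>auto simp: ac_simps\<close>)
    then have "t = 0"
      by (intro poly_mapping_eqI) (metis add_is_0 lookup_add lookup_zero)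
    then show "a \<in> G" using g m by simp
  qed
  show ?thesis
    unfolding min_gens_def
  proof (rule the_equality)
    have "Idl\<^bsub>poly_ring n\<^esub> H \<noteq> Idl\<^bsub>poly_ring n\<^esub> A" if "H \<subset> A" for H
      using A_sub[of H] that Amon by blast
    then show "A \<subseteq> monomials n \<and> minimally_generates n A (Idl\<^bsub>poly_ring n\<^esub> A)"
      using Amon by (simp add: minimally_generates_def)
  next
    fix G assume "G \<subseteq> monomials n \<and> minimally_generates n G (Idl\<^bsub>poly_ring n\<^esub> A)"
    then show "G = A"
      using A_sub[of G] unfolding minimally_generates_def by blast
  qed
qed

text \<open>
  This removes the ideals from the problem: every set of monomials of the right degree and
  cardinality occurs, as the minimal generators of the ideal that it generates.
\<close>
lemma half_gens_eq:
  "(half_gens n d :: 'k::field mpoly set set) =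
     {A. A \<subseteq> squarefree_monomials_deg n d \<and> 2 * card A = n choose d}"
proof (intro equalityI subsetI)
  fix A :: "'k mpoly set"
  assume "A \<in> {A. A \<subseteq> squarefree_monomials_deg n d \<and> 2 * card A = n choose d}"
  then have A: "A \<subseteq> squarefree_monomials_deg n d" "2 * card A = n choose d" by auto
  have "squarefree_monomials_deg n d \<subseteq> (squarefree_monomials n :: 'k mpoly set)"
    by (auto simp: squarefree_monomials_deg_def squarefree_monomials_def)
  then have "squarefree_monomial_ideal n (Idl\<^bsub>poly_ring n\<^esub> A)"
    using A unfolding squarefree_monomial_ideal_def by blast
  then show "A \<in> half_gens n d"
    unfolding half_gens_def half_ideals_def
    using A min_gens_Idl[OF A(1)] by (intro image_eqI[of _ _ "Idl\<^bsub>poly_ring n\<^esub> A"]) auto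
qed (auto simp: half_gens_def half_ideals_def)

section \<open>Random halves of a finite set\<close>

lemma card_subsets_avoiding:
  assumes "finite V" "K \<subseteq> V"
  shows "card {A. A \<subseteq> V \<and> card A = h \<and> A \<inter> K = {}} = (card V - card K) choose h"
proof -
  have "{A. A \<subseteq> V \<and> card A = h \<and> A \<inter> K = {}} = {A. A \<subseteq> V - K \<and> card A = h}"
    using assms by auto
  then show ?thesis
    using assms n_subsets[of "V - K" h] by (simp add: card_Diff_subset finite_subset)
qed

text \<open>
  When \<open>k\<close> grows by 1, the number of \<open>h\<close>-sets avoiding a given \<open>k\<close>-set is multiplied by
  $(h-k)/(2h-k)$. This factor is at most $1/2$, and at least $1/3$ as long as \<open>2k \<le> h\<close>; hence the two
  estimates below.
\<close>
lemma binomial_step: "k < h \<Longrightarrow> (h - k) * ((2 * h - k) choose h) = (2 * h - k) * ((2 * h - Suc k) choose h)"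
  using binomial_absorb_comp[of "2 * h - k" h] by (simp add: mult_2)

lemma binomial_drop_upper: "0 < h \<Longrightarrow> 2 ^ k * ((2 * h - k) choose h) \<le> (2 * h) choose h"
proof (induction k)
  case (Suc k)
  show ?case
  proof (cases "k < h")
    case True
    have "(h - k) * (2 * ((2 * h - Suc k) choose h)) \<le> (2 * h - k) * ((2 * h - Suc k) choose h)"
      unfolding mult.assoc[symmetric] by (rule mult_right_mono) auto
    also have "\<dots> = (h - k) * ((2 * h - k) choose h)"
      using binomial_step[OF True] by simp
    finally have "2 * ((2 * h - Suc k) choose h) \<le> (2 * h - k) choose h"
      using True by simp
    then have "2 ^ k * (2 * ((2 * h - Suc k) choose h)) \<le> 2 ^ k * ((2 * h - k) choose h)"
      by (rule mult_left_mono) simp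
    from order_trans[OF this Suc.IH[OF Suc.prems]] show ?thesis
      by (simp only: power_Suc mult_ac)
  next
    case False
    then have "2 * h - Suc k < h" using Suc.prems by linarith
    then show ?thesis by (simp add: binomial_eq_0)
  qed
qed simp

lemma binomial_drop_lower: "2 * k \<le> h \<Longrightarrow> (2 * h) choose h \<le> 3 ^ k * ((2 * h - k) choose h)"
proof (induction k)
  case (Suc k)
  then have "k < h" by simp
  have "(h - k) * ((2 * h - k) choose h) = (2 * h - k) * ((2 * h - Suc k) choose h)"
    by (rule binomial_step) fact
  also have "\<dots> \<le> (h - k) * (3 * ((2 * h - Suc k) choose h))"
    unfolding mult.assoc[symmetric] by (rule mult_right_mono) (use Suc.prems in auto)
  finally have "(2 * h - k) choose h \<le> 3 * ((2 * h - Suc k) choose h)"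
    using \<open>k < h\<close> by simp
  then have "3 ^ k * ((2 * h - k) choose h) \<le> 3 ^ k * (3 * ((2 * h - Suc k) choose h))"
    by (rule mult_left_mono) simp
  moreover have "(2 * h) choose h \<le> 3 ^ k * ((2 * h - k) choose h)"
    using Suc by simp
  ultimately show ?case by (simp only: power_Suc mult_ac)
qed simp

text \<open>
  Each of the \<open>k\<close> factors of $\binom{L+k}{h} / \binom{L}{h}$ has the form $j/(j-h)$, which decreases
  in \<open>j\<close>. For \<open>M = L + k\<close> this is the log-concavity by which the events of missing two disjoint
  \<open>k\<close>-sets are not positively correlated.
\<close>
lemma binomial_ratio_antimono:
  assumes "L \<le> M"
  shows "((M + k) choose h) * (L choose h) \<le> ((L + k) choose h) * (M choose h)"
proof (induction k)
  case (Suc k)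
  show ?case
  proof (cases "h \<le> L")
    case True
    have step: "real ((Suc j) choose h) = real (Suc j) / real (Suc j - h) * real (j choose h)"
      if "h \<le> j" for j
    proof -
      have "real (Suc j - h) * real (Suc j choose h) = real (Suc j) * real (j choose h)"
        using binomial_absorb_comp[of "Suc j" h] by (simp only: diff_Suc_1 flip: of_nat_mult)
      moreover have "real (Suc j - h) \<noteq> 0" using that by simp
      ultimately show ?thesis by (simp add: nonzero_eq_divide_eq mult.commute)
    qed
    have "real (Suc (M + k)) / real (Suc (M + k) - h) \<le> real (Suc (L + k)) / real (Suc (L + k) - h)"
    proof -
      have "h \<le> M" using True assms by simp
      have "real (Suc (M + k)) * real (Suc (L + k) - h) \<le> real (Suc (L + k)) * real (Suc (M + k) - h)"
        using True \<open>h \<le> M\<close> assms mult_left_mono[of "real L" "real M" "real h"]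
        by (simp add: of_nat_diff algebra_simps)
      then show ?thesis using True \<open>h \<le> M\<close> by (simp add: divide_simps)
    qed
    from mult_mono[OF this Suc.IH[folded of_nat_le_iff[where 'a = real]]]
    have "real (Suc (M + k) choose h) * real (L choose h) \<le> real (Suc (L + k) choose h) * real (M choose h)"
      using True assms by (simp only: step[of "M + k"] step[of "L + k"] of_nat_mult) (simp add: mult_ac)
    then show ?thesis by (simp flip: of_nat_mult)
  qed (simp add: binomial_eq_0)
qed simp

text \<open>
  Chebyshev's inequality for the number \<open>X\<close> of sets \<open>K i\<close> missed by a random \<open>h\<close>-subset of \<open>V\<close>, in the
  form $P(X = 0) \le \operatorname{Var} X / (E X)^2$. As the events of missing the different \<open>K i\<close> are not
  positively correlated, $\operatorname{Var} X \le E X$, and so $P(X = 0) \le 1 / E X$. Clearing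
  denominators gives the inequality of integers.
\<close>
lemma card_hitting_disjoint_family:
  fixes K :: "'i \<Rightarrow> 'a set"
  assumes V: "finite V" and I: "finite I"
    and K: "\<And>i. i \<in> I \<Longrightarrow> K i \<subseteq> V" "\<And>i. i \<in> I \<Longrightarrow> card (K i) = k"
    and disj: "disjoint_family_on K I"
  shows "card {A. A \<subseteq> V \<and> card A = h \<and> (\<forall>i\<in>I. A \<inter> K i \<noteq> {})} *
           (card I * ((card V - k) choose h)) \<le> (card V choose h) ^ 2"
    (is "card ?Z * _ \<le> _")
proof -
  define \<Omega> where "\<Omega> = {A. A \<subseteq> V \<and> card A = h}"
  \<comment> \<open>\<open>a / T\<close> is the probability of missing a given one of the sets, \<open>b / T\<close> that of missing two
      given ones. Sums over \<open>\<Omega>\<close> are \<open>T\<close> times expectations.\<close>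
  define T where "T = real (card V choose h)"
  define a where "a = real ((card V - k) choose h)"
  define b where "b = real ((card V - 2 * k) choose h)"
  define m where "m = real (card I)"
  define X where "X A = (\<Sum>i\<in>I. of_bool (A \<inter> K i = {}) :: real)" for A
  have fin: "finite \<Omega>"
    using V by (auto simp: \<Omega>_def intro: finite_subset[of _ "Pow V"])
  have card_\<Omega>: "real (card \<Omega>) = T"
    using n_subsets[OF V, of h] by (simp add: \<Omega>_def T_def)
  have T: "T \<ge> 0" and a: "a \<ge> 0" and m: "m \<ge> 0" by (simp_all add: T_def a_def m_def)
  have avoid: "(\<Sum>A\<in>\<Omega>. of_bool (A \<inter> L = {})) = real ((card V - card L) choose h)" if "L \<subseteq> V" for L
  proof -
    have "(\<Sum>A\<in>\<Omega>. of_bool (A \<inter> L = {})) = real (card {A\<in>\<Omega>. A \<inter> L = {}})"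
      using fin by (simp add: sum.If_cases of_bool_def Int_def)
    also have "{A\<in>\<Omega>. A \<inter> L = {}} = {A. A \<subseteq> V \<and> card A = h \<and> A \<inter> L = {}}"
      by (auto simp: \<Omega>_def)
    finally show ?thesis using card_subsets_avoiding[OF V that, of h] by simp
  qed
  have first_moment: "(\<Sum>A\<in>\<Omega>. X A) = m * a"
    unfolding X_def by (subst sum.swap) (simp add: avoid K m_def a_def)
  \<comment> \<open>The events of missing two different sets are not positively correlated.\<close>
  have ab: "b * T \<le> a * a" if "i \<in> I" "j \<in> I" "i \<noteq> j" for i j
  proof -
    have "card (K i \<union> K j) = 2 * k"
      using that disj K finite_subset[OF _ V]
      by (subst card_Un_disjoint) (auto simp: disjoint_family_on_def)
    then have "2 * k \<le> card V"
      using card_mono[OF V, of "K i \<union> K j"] K that by simp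
    then have "card V - k = (card V - 2 * k) + k" "card V = (card V - k) + k" by simp_all
    then show ?thesis
      using binomial_ratio_antimono[of "card V - 2 * k" "card V - k" k h]
      unfolding a_def b_def T_def by (metis diff_le_mono2 le_add2 mult.commute mult_2 of_nat_le_iff of_nat_mult)
  qed
  have pair: "T * (\<Sum>A\<in>\<Omega>. of_bool (A \<inter> K i = {}) * of_bool (A \<inter> K j = {})) \<le>
      a * a + (if i = j then T * a else 0)" if "i \<in> I" "j \<in> I" for i j
  proof (cases "i = j")
    case True
    then show ?thesis using avoid[of "K i"] K that by (simp add: a_def flip: of_bool_conj)
  next
    case False
    have "(\<Sum>A\<in>\<Omega>. of_bool (A \<inter> K i = {}) * of_bool (A \<inter> K j = {})) =
          (\<Sum>A\<in>\<Omega>. of_bool (A \<inter> (K i \<union> K j) = {}) :: real)"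
      by (intro sum.cong) auto
    also have "\<dots> = real ((card V - card (K i \<union> K j)) choose h)"
      using K that by (intro avoid) auto
    also have "card (K i \<union> K j) = 2 * k"
      using that False disj K finite_subset[OF _ V]
      by (subst card_Un_disjoint) (auto simp: disjoint_family_on_def)
    finally show ?thesis using ab[OF that False] False by (simp add: b_def mult.commute)
  qed
  have "T * (\<Sum>A\<in>\<Omega>. (X A)\<^sup>2) =
      (\<Sum>i\<in>I. \<Sum>j\<in>I. T * (\<Sum>A\<in>\<Omega>. of_bool (A \<inter> K i = {}) * of_bool (A \<inter> K j = {})))"
  proof -
    have "(\<Sum>A\<in>\<Omega>. (X A)\<^sup>2) =
        (\<Sum>A\<in>\<Omega>. \<Sum>i\<in>I. \<Sum>j\<in>I. of_bool (A \<inter> K i = {}) * of_bool (A \<inter> K j = {}))"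
      by (simp add: X_def power2_eq_square sum_product)
    also have "\<dots> = (\<Sum>i\<in>I. \<Sum>A\<in>\<Omega>. \<Sum>j\<in>I. of_bool (A \<inter> K i = {}) * of_bool (A \<inter> K j = {}))"
      by (rule sum.swap)
    also have "\<dots> = (\<Sum>i\<in>I. \<Sum>j\<in>I. \<Sum>A\<in>\<Omega>. of_bool (A \<inter> K i = {}) * of_bool (A \<inter> K j = {}))"
      by (intro sum.cong refl sum.swap)
    finally show ?thesis by (simp add: sum_distrib_left)
  qed
  also have "\<dots> \<le> (\<Sum>i\<in>I. \<Sum>j\<in>I. a * a + (if i = j then T * a else 0))"
    by (intro sum_mono pair)
  also have "\<dots> = m * (m * (a * a)) + m * (T * a)"
    using I by (simp add: sum.distrib m_def distrib_left)
  finally have second_moment: "T * (\<Sum>A\<in>\<Omega>. (X A)\<^sup>2) \<le> m * (m * (a * a)) + m * (T * a)" .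
  \<comment> \<open>Each \<open>A\<close> counted on the left has \<open>X A = 0\<close>, so it contributes \<open>(m * a)\<^sup>2\<close> to the sum of the
      squared deviations of \<open>T * X\<close> from its mean \<open>m * a\<close>.\<close>
  have "real (card ?Z) * (m * a)\<^sup>2 = (\<Sum>A\<in>?Z. (T * X A - m * a)\<^sup>2)"
    by (subst sum.cong[where h = "\<lambda>_. (m * a)\<^sup>2", OF refl]) (auto simp: X_def)
  also have "\<dots> \<le> (\<Sum>A\<in>\<Omega>. (T * X A - m * a)\<^sup>2)"
    by (rule sum_mono2[OF fin]) (auto simp: \<Omega>_def)
  also have "\<dots> = T * (T * (\<Sum>A\<in>\<Omega>. (X A)\<^sup>2)) - 2 * T * (m * a) * (\<Sum>A\<in>\<Omega>. X A) + T * (m * a)\<^sup>2"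
    by (simp add: power2_diff sum.distrib sum_subtractf power_mult_distrib card_\<Omega>
        flip: sum_distrib_left sum_distrib_right)
       (simp add: sum_distrib_left sum_distrib_right power2_eq_square mult_ac)
  also have "\<dots> \<le> T * (m * (m * (a * a)) + m * (T * a)) - 2 * T * (m * a) * (m * a) + T * (m * a)\<^sup>2"
    using mult_left_mono[OF second_moment T] by (simp add: first_moment)
  also have "\<dots> = T\<^sup>2 * (m * a)"
    by (simp add: power2_eq_square algebra_simps)
  finally have main: "(real (card ?Z) * (m * a)) * (m * a) \<le> T\<^sup>2 * (m * a)"
    by (simp add: power2_eq_square mult_ac)
  have "real (card ?Z) * (m * a) \<le> T\<^sup>2"
  proof (cases "m * a = 0")
    case False
    then have "m * a > 0" using m a by (simp add: less_le)
    then show ?thesis using main by (rule mult_right_le_imp_le[rotated])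
  next
    case True
    then show ?thesis by (simp only: mult_zero_right zero_le_power2)
  qed
  then have "real (card ?Z * (card I * ((card V - k) choose h))) \<le> real ((card V choose h) ^ 2)"
    by (simp add: m_def a_def T_def)
  then show ?thesis by (simp only: of_nat_le_iff)
qed

text \<open>
  The union bound.
\<close>
lemma card_missing_some:
  assumes V: "finite V" "card V = 2 * h" "0 < h" and I: "finite I"
    and K: "\<And>i. i \<in> I \<Longrightarrow> K i \<subseteq> V" "\<And>i. i \<in> I \<Longrightarrow> card (K i) = k"
  shows "card {A. A \<subseteq> V \<and> card A = h \<and> (\<exists>i\<in>I. A \<inter> K i = {})} * 2 ^ k \<le> card I * ((2 * h) choose h)"
proof -
  have "{A. A \<subseteq> V \<and> card A = h \<and> (\<exists>i\<in>I. A \<inter> K i = {})} =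
        (\<Union>i\<in>I. {A. A \<subseteq> V \<and> card A = h \<and> A \<inter> K i = {}})" by auto
  also have "card \<dots> \<le> (\<Sum>i\<in>I. card {A. A \<subseteq> V \<and> card A = h \<and> A \<inter> K i = {}})"
    by (rule card_UN_le[OF I])
  also have "\<dots> = card I * ((2 * h - k) choose h)"
    using card_subsets_avoiding[OF V(1)] K V(2) by simp
  finally show ?thesis
    using binomial_drop_upper[OF V(3), of k] by (smt (verit) mult.assoc mult.commute mult_le_mono order_trans order_refl)
qed

text \<open>
  At least four disjoint \<open>k\<close>-sets fit into \<open>V\<close> only if \<open>2k \<le> h\<close>, which is the range where each of them is
  missed with probability at least $3^{-k}$.
\<close>
lemma card_hitting_disjoint_family_half:
  assumes V: "finite V" "card V = 2 * h" and I: "finite I" "4 \<le> card I"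
    and K: "\<And>i. i \<in> I \<Longrightarrow> K i \<subseteq> V" "\<And>i. i \<in> I \<Longrightarrow> card (K i) = k"
    and disj: "disjoint_family_on K I"
  shows "card {A. A \<subseteq> V \<and> card A = h \<and> (\<forall>i\<in>I. A \<inter> K i \<noteq> {})} * card I \<le> 3 ^ k * ((2 * h) choose h)"
    (is "?z * _ \<le> _")
proof -
  have "card I * k = card (\<Union>i\<in>I. K i)"
    using K finite_subset[OF _ V(1)] I disj
    by (subst card_UN_disjoint) (auto simp: disjoint_family_on_def)
  also have "\<dots> \<le> 2 * h"
    using K card_mono[OF V(1), of "\<Union>i\<in>I. K i"] V(2) by auto
  finally have "4 * k \<le> 2 * h"
    using mult_le_mono1[OF I(2), of k] by linarith
  then have low: "(2 * h) choose h \<le> 3 ^ k * ((2 * h - k) choose h)"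
    by (intro binomial_drop_lower) simp
  have "(?z * card I) * ((2 * h) choose h) \<le> (?z * card I) * (3 ^ k * ((2 * h - k) choose h))"
    using low by (rule mult_left_mono) simp
  also have "\<dots> = 3 ^ k * (?z * (card I * ((2 * h - k) choose h)))" by (simp add: mult_ac)
  also have "\<dots> \<le> 3 ^ k * ((2 * h) choose h) ^ 2"
    using card_hitting_disjoint_family[OF V(1) I(1) K disj, of h] V(2)
    by (intro mult_left_mono) auto
  finally have "(?z * card I) * ((2 * h) choose h) \<le> (3 ^ k * ((2 * h) choose h)) * ((2 * h) choose h)"
    by (simp add: power2_eq_square mult_ac)
  then show ?thesis by (rule mult_right_le_imp_le) simp
qed

section \<open>Squarefree monomials as sets of variables\<close>

definition squarefree_monomial :: "nat set \<Rightarrow> 'k::field mpoly" where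
  "squarefree_monomial S = monomial (\<Sum>i\<in>S. Poly_Mapping.single i 1)"

lemma lookup_sum_single:
  "finite S \<Longrightarrow> Poly_Mapping.lookup (\<Sum>i\<in>S. Poly_Mapping.single i (1::nat)) j = of_bool (j \<in> S)"
  by (simp add: lookup_sum lookup_single when_def)

lemma squarefree_monomial_eq_iff:
  assumes "finite S" "finite T"
  shows "(squarefree_monomial S :: 'k::field mpoly) = squarefree_monomial T \<longleftrightarrow> S = T"
proof
  assume "(squarefree_monomial S :: 'k mpoly) = squarefree_monomial T"
  then have "of_bool (j \<in> S) = (of_bool (j \<in> T) :: nat)" for j
    using lookup_sum_single[OF assms(1), of j] lookup_sum_single[OF assms(2), of j]
    by (simp add: squarefree_monomial_def monomial_eq_iff)
  then show "S = T" by (auto simp: of_bool_eq_iff)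
qed simp

lemma squarefree_monomials_deg_eq_image:
  "(squarefree_monomials_deg n d :: 'k::field mpoly set) =
     squarefree_monomial ` {S. S \<subseteq> {1..n} \<and> card S = d}"
proof (intro equalityI subsetI)
  fix p :: "'k mpoly" assume "p \<in> squarefree_monomials_deg n d"
  then obtain m where m: "p = monomial m" "Poly_Mapping.keys m \<subseteq> {1..n}"
      "\<And>i. Poly_Mapping.lookup m i \<le> 1" "(\<Sum>i\<in>{1..n}. Poly_Mapping.lookup m i) = d"
    by (auto simp: squarefree_monomials_deg_def)
  define S where "S = Poly_Mapping.keys m"
  have m_eq: "Poly_Mapping.lookup m i = of_bool (i \<in> S)" for i
    using m(3)[of i] by (auto simp: S_def in_keys_iff)
  have "m = (\<Sum>i\<in>S. Poly_Mapping.single i 1)"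
    by (rule poly_mapping_eqI) (subst lookup_sum_single, simp_all only: m_eq S_def finite_keys)
  moreover have "{1..n} \<inter> S = S" using m(2) by (auto simp: S_def)
  then have "card S = d" using m(4) by (simp add: m_eq)
  ultimately show "p \<in> squarefree_monomial ` {S. S \<subseteq> {1..n} \<and> card S = d}"
    using m(1,2) by (intro image_eqI[of _ _ S]) (simp_all add: squarefree_monomial_def S_def)
next
  fix p :: "'k mpoly" assume "p \<in> squarefree_monomial ` {S. S \<subseteq> {1..n} \<and> card S = d}"
  then obtain S where S: "p = squarefree_monomial S" "S \<subseteq> {1..n}" "card S = d" by auto
  then have fin: "finite S" using finite_subset by blast
  have "{1..n} \<inter> S = S" using S by auto
  then show "p \<in> squarefree_monomials_deg n d"
    unfolding squarefree_monomials_deg_def mem_Collect_eq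
    using S by (intro exI[of _ "\<Sum>i\<in>S. Poly_Mapping.single i 1"])
      (simp add: squarefree_monomial_def lookup_sum_single[OF fin, unfolded One_nat_def]
        in_keys_iff subset_iff)
qed

lemma squarefree_monomial_in_deg_iff:
  assumes "finite S"
  shows "(squarefree_monomial S :: 'k::field mpoly) \<in> squarefree_monomials_deg n d \<longleftrightarrow>
           S \<subseteq> {1..n} \<and> card S = d"
proof
  assume "squarefree_monomial S \<in> (squarefree_monomials_deg n d :: 'k mpoly set)"
  then obtain T where T: "T \<subseteq> {1..n}" "card T = d"
      "(squarefree_monomial S :: 'k mpoly) = squarefree_monomial T"
    by (auto simp: squarefree_monomials_deg_eq_image)
  then have "S = T"
    using assms finite_subset[OF T(1)] by (simp add: squarefree_monomial_eq_iff)
  with T show "S \<subseteq> {1..n} \<and> card S = d" by simp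
qed (simp add: squarefree_monomials_deg_eq_image)

lemma inj_on_squarefree_monomial:
  "inj_on (squarefree_monomial :: nat set \<Rightarrow> 'k::field mpoly) {S. finite S}"
  by (auto simp: inj_on_def squarefree_monomial_eq_iff)

lemma finite_squarefree_monomials_deg: "finite (squarefree_monomials_deg n d)"
  by (simp add: squarefree_monomials_deg_eq_image)

lemma card_squarefree_monomials_deg:
  "card (squarefree_monomials_deg n d :: 'k::field mpoly set) = n choose d"
proof -
  have "card (squarefree_monomials_deg n d :: 'k mpoly set) = card {S. S \<subseteq> {1..n} \<and> card S = d}"
    unfolding squarefree_monomials_deg_eq_image
    by (intro card_image inj_on_subset[OF inj_on_squarefree_monomial])
      (auto intro: finite_subset)
  then show ?thesis by (simp add: n_subsets)
qed

lemma squarefree_monomial_mult_var: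
  "finite S \<Longrightarrow> i \<notin> S \<Longrightarrow> squarefree_monomial S * var i = squarefree_monomial (insert i S)"
  by (simp add: squarefree_monomial_def var_def monomial_def mult_single add.commute)

text \<open>
  Division by a variable, with the quotient \<open>p\<close> an arbitrary polynomial: comparing exponents
  shows that \<open>x\<^sub>i\<close> occurs in the product, and the quotient is unique as there are no zero divisors.
\<close>
lemma mult_var_eq_squarefree_monomial_iff:
  fixes p :: "'k::field mpoly"
  assumes T: "finite T"
  shows "p * var i = squarefree_monomial T \<longleftrightarrow> i \<in> T \<and> p = squarefree_monomial (T - {i})"
proof
  assume eq: "p * var i = squarefree_monomial T"
  have "i \<in> T"
  proof -
    have "(\<Sum>i\<in>T. Poly_Mapping.single i 1) \<in> Poly_Mapping.keys (p * var i)"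
      by (simp add: eq squarefree_monomial_def monomial_def)
    then obtain u where "(\<Sum>i\<in>T. Poly_Mapping.single i 1) = u + Poly_Mapping.single i (1::nat)"
      using Poly_Mapping.keys_mult[of p "var i"] by (auto simp: var_def monomial_def)
    then have "of_bool (i \<in> T) = Poly_Mapping.lookup u i + 1"
      using lookup_sum_single[OF T, of i] by (simp add: lookup_add)
    then show ?thesis by (cases "i \<in> T") auto
  qed
  then have "p * var i = squarefree_monomial (T - {i}) * var i"
    using T eq by (simp add: squarefree_monomial_mult_var insert_absorb)
  moreover have "(var i :: 'k mpoly) \<noteq> 0"
    unfolding var_def monomial_def by (metis keys_single keys_zero insert_not_empty zero_neq_one)
  ultimately show "i \<in> T \<and> p = squarefree_monomial (T - {i})"
    using \<open>i \<in> T\<close> by simp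
qed (use T in \<open>auto simp: squarefree_monomial_mult_var insert_absorb\<close>)

section \<open>Perfect sets as hitting sets\<close>

lemma lower_perfectI:
  fixes A :: "'k::field mpoly set"
  assumes d: "1 \<le> d" and A: "A \<subseteq> squarefree_monomials_deg n d"
    and hit: "\<And>S. S \<subseteq> {1..n} \<Longrightarrow> card S = d - 1 \<Longrightarrow>
                A \<inter> squarefree_monomial ` (\<lambda>i. insert i S) ` ({1..n} - S) \<noteq> {}"
  shows "lower_perfect n d A"
  unfolding lower_perfect_def
proof (intro equalityI subsetI)
  fix p assume "p \<in> {h. \<exists>g\<in>A. \<exists>i\<in>{1..n}. h * var i = g}"
  then obtain i where pi: "p * var i \<in> A" by auto
  then obtain T where T: "T \<subseteq> {1..n}" "card T = d" "p * var i = squarefree_monomial T"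
    using A by (auto simp: squarefree_monomials_deg_eq_image)
  have fin: "finite T" using T(1) finite_subset by blast
  have "i \<in> T" "p = squarefree_monomial (T - {i})"
    using T(3) by (simp_all add: mult_var_eq_squarefree_monomial_iff[OF fin])
  then show "p \<in> squarefree_monomials_deg n (d - 1)"
    using T fin by (auto simp: squarefree_monomial_in_deg_iff)
next
  fix p :: "'k mpoly" assume "p \<in> squarefree_monomials_deg n (d - 1)"
  then obtain S where S: "S \<subseteq> {1..n}" "card S = d - 1" "p = squarefree_monomial S"
    by (auto simp: squarefree_monomials_deg_eq_image)
  obtain i where i: "i \<in> {1..n} - S" "squarefree_monomial (insert i S) \<in> A"
    using hit[OF S(1,2)] by blast
  then show "p \<in> {h. \<exists>g\<in>A. \<exists>i\<in>{1..n}. h * var i = g}"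
    using S(3) squarefree_monomial_mult_var[of S i] finite_subset[OF S(1)]
    by (auto intro!: bexI[of _ i])
qed

lemma upper_perfectD:
  fixes A :: "'k::field mpoly set"
  assumes up: "upper_perfect n d A"
    and T: "T \<subseteq> {1..n}" "card T = d + 1"
  shows "A \<inter> squarefree_monomial ` {S. S \<subseteq> T \<and> card S = d} \<noteq> {}"
proof -
  have fin: "finite T" using T(1) finite_subset by blast
  have "squarefree_monomial T \<in> squarefree_monomials_deg n (d + 1)"
    using T by (auto simp: squarefree_monomials_deg_eq_image)
  then have "(squarefree_monomial T :: 'k mpoly) \<in> {f * var i |f i. f \<in> A \<and> i \<in> {1..n} \<and> \<not> var i dvd f}"
    using up by (simp only: upper_perfect_def)
  then obtain f i where fi: "f \<in> A" "f * var i = squarefree_monomial T"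
    by (smt (verit) mem_Collect_eq)
  then have "i \<in> T" "f = squarefree_monomial (T - {i})"
    by (simp_all add: mult_var_eq_squarefree_monomial_iff[OF fin])
  then show ?thesis using fi(1) T(2) by auto
qed

section \<open>Proportions of perfect sets\<close>

lemma half_gens_eq_half:
  assumes "n choose d = 2 * h"
  shows "(half_gens n d :: 'k::field mpoly set set) =
           {A. A \<subseteq> squarefree_monomials_deg n d \<and> card A = h}"
  using assms by (auto simp: half_gens_eq)

lemma card_half_gens:
  assumes "n choose d = 2 * h"
  shows "card (half_gens n d :: 'k::field mpoly set set) = (2 * h) choose h"
  using n_subsets[OF finite_squarefree_monomials_deg, of n d h, where ?'a1 = 'k] assms
  by (simp add: half_gens_eq_half card_squarefree_monomials_deg)

text \<open>
  The \<open>d\<close>-sets containing a given \<open>(d-1)\<close>-set arise by adding one of the \<open>n - (d - 1)\<close> remaining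
  elements, so a random half misses all of them with probability exponentially small in \<open>n\<close>.
\<close>
lemma LP_ratio_ge:
  assumes d: "1 \<le> d" "d \<le> n" and even: "even (n choose d)"
  shows "1 - real (n choose (d - 1)) / 2 ^ (n - (d - 1)) \<le>
     real (card (LP n d \<inter> (half_gens n d :: 'k::field mpoly set set)))
       / real (card (half_gens n d :: 'k mpoly set set))"
proof -
  let ?H = "half_gens n d :: 'k mpoly set set" and ?k = "n - (d - 1)"
  let ?V = "{S. S \<subseteq> {1..n} \<and> card S = d - 1}"
  define L :: "nat set \<Rightarrow> 'k mpoly set"
    where "L S = squarefree_monomial ` (\<lambda>i. insert i S) ` ({1..n} - S)" for S
  obtain h where h: "n choose d = 2 * h" using even by auto
  have "0 < h" using h d zero_less_binomial[of d n] by simp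
  have L_sub: "L S \<subseteq> squarefree_monomials_deg n d" and L_card: "card (L S) = ?k"
    if "S \<in> ?V" for S
  proof -
    have fin: "finite S" using that by (auto intro: finite_subset)
    show "L S \<subseteq> squarefree_monomials_deg n d"
      using that d fin by (auto simp: L_def squarefree_monomial_in_deg_iff)
    have "card (L S) = card ((\<lambda>i. insert i S) ` ({1..n} - S))"
      unfolding L_def using fin
      by (intro card_image inj_on_subset[OF inj_on_squarefree_monomial]) auto
    also have "\<dots> = card ({1..n} - S)"
      by (intro card_image) (auto simp: inj_on_def)
    finally show "card (L S) = ?k"
      using that fin by (simp add: card_Diff_subset)
  qed
  have fin: "finite ?H"
    using finite_squarefree_monomials_deg[of n d, where ?'a = 'k]
    by (auto simp: half_gens_eq intro: finite_subset[of _ "Pow (squarefree_monomials_deg n d)"])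
  have "?H - LP n d \<subseteq> {A. A \<subseteq> squarefree_monomials_deg n d \<and> card A = h \<and> (\<exists>S\<in>?V. A \<inter> L S = {})}"
  proof
    fix A assume A: "A \<in> ?H - LP n d"
    then have sub: "A \<subseteq> squarefree_monomials_deg n d" "card A = h"
      by (auto simp: half_gens_eq_half[OF h])
    then have "\<not> lower_perfect n d A" using A by (auto simp: LP_def)
    then have "\<exists>S\<in>?V. A \<inter> L S = {}"
      using lower_perfectI[OF d(1) sub(1)] unfolding L_def by blast
    with sub show "A \<in> {A. A \<subseteq> squarefree_monomials_deg n d \<and> card A = h \<and> (\<exists>S\<in>?V. A \<inter> L S = {})}"
      by blast
  qed
  then have "card (?H - LP n d) \<le>
      card {A. A \<subseteq> squarefree_monomials_deg n d \<and> card A = h \<and> (\<exists>S\<in>?V. A \<inter> L S = {})}"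
    using finite_squarefree_monomials_deg[of n d, where ?'a = 'k]
    by (intro card_mono) (auto intro: finite_subset[of _ "Pow (squarefree_monomials_deg n d)"])
  also have "\<dots> * 2 ^ ?k \<le> card ?V * ((2 * h) choose h)"
    by (rule card_missing_some[OF finite_squarefree_monomials_deg _ \<open>0 < h\<close>])
      (use L_sub L_card in \<open>auto simp: card_squarefree_monomials_deg h\<close>)
  finally have "card (?H - LP n d) * 2 ^ ?k \<le> (n choose (d - 1)) * card ?H"
    by (simp add: n_subsets card_half_gens[OF h])
  then have "real (card (?H - LP n d)) * 2 ^ ?k \<le> real (n choose (d - 1)) * real (card ?H)"
    by (metis of_nat_le_iff of_nat_mult of_nat_numeral of_nat_power)
  moreover have "real (card ?H) > 0" by (simp add: card_half_gens[OF h])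
  moreover have "real (card ?H) = real (card (LP n d \<inter> ?H)) + real (card (?H - LP n d))"
    using card_Int_Diff[OF fin, of "LP n d"] by (simp add: Int_commute)
  ultimately show ?thesis by (simp add: field_simps)
qed

text \<open>
  Consecutive blocks of length \<open>d + 1\<close> are disjoint, and so are their families of (nonempty)
  \<open>d\<close>-subsets. The lower bound on \<open>n\<close> provides four blocks.
\<close>
lemma UP_ratio_le:
  assumes d: "1 \<le> d" "4 * (d + 1) \<le> n" and even: "even (n choose d)"
  shows "real (card (UP n d \<inter> (half_gens n d :: 'k::field mpoly set set)))
       / real (card (half_gens n d :: 'k mpoly set set)) \<le> 3 ^ (d + 1) / real (n div (d + 1))"
proof -
  let ?H = "half_gens n d :: 'k mpoly set set" and ?m = "n div (d + 1)"
  define B where "B i = {i * (d + 1) <.. Suc i * (d + 1)}" for i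
  define K :: "nat \<Rightarrow> 'k mpoly set"
    where "K i = squarefree_monomial ` {S. S \<subseteq> B i \<and> card S = d}" for i
  obtain h where h: "n choose d = 2 * h" using even by auto
  let ?Z = "{A. A \<subseteq> squarefree_monomials_deg n d \<and> card A = h \<and> (\<forall>i\<in>{..<?m}. A \<inter> K i \<noteq> {})}"
  have m: "4 \<le> ?m"
    using div_le_mono[OF d(2), of "d + 1"]
    by (metis add_is_0 nonzero_mult_div_cancel_right one_neq_zero)
  have B_card: "card (B i) = d + 1" for i by (simp add: B_def)
  have B_sub: "B i \<subseteq> {1..n}" if "i < ?m" for i
  proof -
    have "Suc i * (d + 1) \<le> ?m * (d + 1)" using that by (intro mult_le_mono1) simp
    also have "\<dots> \<le> n" by (rule div_times_less_eq_dividend)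
    finally show ?thesis by (auto simp: B_def)
  qed
  have B_less: "B i \<inter> B j = {}" if "i < j" for i j
  proof -
    have "Suc i * (d + 1) \<le> j * (d + 1)" using that by (intro mult_le_mono1) simp
    then show ?thesis by (auto simp: B_def)
  qed
  have disj: "disjoint_family_on K {..<?m}"
    unfolding disjoint_family_on_def
  proof (intro ballI impI)
    fix i j :: nat assume "i \<noteq> j"
    then have BB: "B i \<inter> B j = {}"
      using B_less[of i j] B_less[of j i] by (cases "i < j") auto
    show "K i \<inter> K j = {}"
    proof (rule ccontr)
      assume "K i \<inter> K j \<noteq> {}"
      then obtain S T where ST: "S \<subseteq> B i" "T \<subseteq> B j" "card S = d"
          "(squarefree_monomial S :: 'k mpoly) = squarefree_monomial T" by (auto simp: K_def)
      moreover have "finite S" "finite T"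
        using ST(1,2) finite_subset by (auto simp: B_def)
      ultimately have "S = {}" using BB by (auto simp: squarefree_monomial_eq_iff)
      then show False using ST(3) d by simp
    qed
  qed
  have "UP n d \<inter> ?H \<subseteq> ?Z"
  proof
    fix A assume "A \<in> UP n d \<inter> ?H"
    then have A: "A \<subseteq> squarefree_monomials_deg n d" "card A = h" "upper_perfect n d A"
      by (auto simp: half_gens_eq_half[OF h] UP_def)
    then show "A \<in> ?Z"
      using upper_perfectD[OF A(3) B_sub B_card] unfolding K_def by blast
  qed
  then have "card (UP n d \<inter> ?H) \<le> card (?Z)"
    using finite_squarefree_monomials_deg[of n d, where ?'a = 'k]
    by (intro card_mono) (auto intro: finite_subset[of _ "Pow (squarefree_monomials_deg n d)"])
  then have "card (UP n d \<inter> ?H) * ?m \<le> card (?Z) * card {..<?m}"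
    by simp
  also have "\<dots> \<le> 3 ^ (d + 1) * ((2 * h) choose h)"
  proof (rule card_hitting_disjoint_family_half[OF finite_squarefree_monomials_deg _ _ _ _ _ disj])
    fix i assume i: "i \<in> {..<?m}"
    show "K i \<subseteq> squarefree_monomials_deg n d"
      using B_sub[of i] i by (auto simp: K_def squarefree_monomials_deg_eq_image)
    have fin: "finite (B i)" by (simp add: B_def)
    have "card (K i) = card {S. S \<subseteq> B i \<and> card S = d}"
      unfolding K_def using finite_subset[OF _ fin]
      by (intro card_image inj_on_subset[OF inj_on_squarefree_monomial]) auto
    then show "card (K i) = d + 1" using fin by (simp add: n_subsets B_card)
  qed (use m in \<open>auto simp: card_squarefree_monomials_deg h\<close>)
  finally have "card (UP n d \<inter> ?H) * ?m \<le> 3 ^ (d + 1) * card ?H"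
    by (simp only: card_half_gens[OF h])
  then have "real (card (UP n d \<inter> ?H)) * real ?m \<le> 3 ^ (d + 1) * real (card ?H)"
    by (metis of_nat_le_iff of_nat_mult of_nat_numeral of_nat_power)
  moreover have "real (card ?H) > 0" by (simp add: card_half_gens[OF h])
  moreover have "real ?m > 0" using m by simp
  ultimately show ?thesis by (simp only: pos_divide_le_eq pos_le_divide_eq times_divide_eq_left)
qed

lemma binomial_over_exponential_tendsto_0:
  "(\<lambda>n. real (n choose r) / 2 ^ (n - r)) \<longlonglongrightarrow> 0"
proof (rule tendsto_sandwich[OF _ _ tendsto_const])
  show "\<forall>\<^sub>F n in sequentially. real (n choose r) / 2 ^ (n - r) \<le> 2 ^ r * (real n ^ r / 2 ^ n)"
    using eventually_ge_at_top[of r]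
  proof eventually_elim
    case (elim n)
    have "real (n choose r) \<le> real n ^ r"
      using binomial_le_pow[OF elim] by (metis of_nat_le_iff of_nat_power)
    then have "real (n choose r) / 2 ^ (n - r) \<le> real n ^ r / 2 ^ (n - r)"
      by (rule divide_right_mono) simp
    also have "\<dots> = 2 ^ r * (real n ^ r / 2 ^ n)"
      using elim by (simp add: power_diff)
    finally show ?case .
  qed
  have "(\<lambda>n. real n ^ r / 2 ^ n) \<longlonglongrightarrow> 0" by real_asymp
  then show "(\<lambda>n. 2 ^ r * (real n ^ r / 2 ^ n)) \<longlonglongrightarrow> 0"
    by (rule tendsto_mult_right_zero)
qed auto

theorem theorem3p2:
  fixes d :: nat
  assumes "d \<ge> 2"
  shows "((\<lambda>n. real (card (LP n d \<inter> (half_gens n d :: 'k::field mpoly set set)))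
             / real (card (half_gens n d :: 'k mpoly set set))) \<longlongrightarrow> 1) (even_binomial_filter d)
       \<and> ((\<lambda>n. real (card (UP n d \<inter> (half_gens n d :: 'k mpoly set set)))
             / real (card (half_gens n d :: 'k mpoly set set))) \<longlongrightarrow> 0) (even_binomial_filter d)"
proof
  have filter_le: "even_binomial_filter d \<le> sequentially"
    by (simp add: even_binomial_filter_def)
  have ev: "\<forall>\<^sub>F n in even_binomial_filter d. d \<le> n \<and> even (n choose d)"
    by (simp add: even_binomial_filter_def eventually_inf_principal)
  show "((\<lambda>n. real (card (LP n d \<inter> (half_gens n d :: 'k mpoly set set)))
             / real (card (half_gens n d :: 'k mpoly set set))) \<longlongrightarrow> 1) (even_binomial_filter d)"
  proof (rule tendsto_sandwich)
    show "\<forall>\<^sub>F n in even_binomial_filter d. 1 - real (n choose (d - 1)) / 2 ^ (n - (d - 1)) \<le>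
        real (card (LP n d \<inter> (half_gens n d :: 'k mpoly set set)))
             / real (card (half_gens n d :: 'k mpoly set set))"
      using ev by eventually_elim (use assms in \<open>intro LP_ratio_ge; simp\<close>)
    show "\<forall>\<^sub>F n in even_binomial_filter d. 
        real (card (LP n d \<inter> (half_gens n d :: 'k mpoly set set)))
             / real (card (half_gens n d :: 'k mpoly set set)) \<le> 1"
      using ev
    proof eventually_elim
      case (elim n)
      obtain h where "n choose d = 2 * h" using elim by auto
      then have "0 < card (half_gens n d :: 'k mpoly set set)"
        by (simp add: card_half_gens)
      then show ?case
        using card_mono[OF card_ge_0_finite, of "half_gens n d :: 'k mpoly set set" "LP n d \<inter> half_gens n d"]
        by simp
    qed
    have "(\<lambda>n. 1 - real (n choose (d - 1)) / 2 ^ (n - (d - 1))) \<longlonglongrightarrow> 1 - 0"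
      by (intro tendsto_diff tendsto_const binomial_over_exponential_tendsto_0)
    then show "((\<lambda>n. 1 - real (n choose (d - 1)) / 2 ^ (n - (d - 1))) \<longlongrightarrow> 1) (even_binomial_filter d)"
      using tendsto_mono[OF filter_le] by simp
  qed simp
  show "((\<lambda>n. real (card (UP n d \<inter> (half_gens n d :: 'k mpoly set set)))
             / real (card (half_gens n d :: 'k mpoly set set))) \<longlongrightarrow> 0) (even_binomial_filter d)"
  proof (rule tendsto_sandwich[OF _ _ tendsto_const])
    have "\<forall>\<^sub>F n in even_binomial_filter d. 4 * (d + 1) \<le> n"
      using filter_le eventually_ge_at_top by (rule filter_leD)
    with ev show "\<forall>\<^sub>F n in even_binomial_filter d.
        real (card (UP n d \<inter> (half_gens n d :: 'k mpoly set set)))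
             / real (card (half_gens n d :: 'k mpoly set set)) \<le> 3 ^ (d + 1) / real (n div (d + 1))"
      by eventually_elim (use assms in \<open>intro UP_ratio_le; simp\<close>)
    have "filterlim (\<lambda>n. n div (d + 1)) at_top sequentially"
      unfolding filterlim_at_top
    proof
      fix m
      show "\<forall>\<^sub>F n in sequentially. m \<le> n div (d + 1)"
        using eventually_ge_at_top[of "m * (d + 1)"]
        by eventually_elim (metis div_le_mono nonzero_mult_div_cancel_right add_is_0 one_neq_zero)
    qed
    then have "(\<lambda>n. 3 ^ (d + 1) / real (n div (d + 1))) \<longlonglongrightarrow> 0"
      by (intro real_tendsto_divide_at_top[OF tendsto_const] filterlim_compose[OF filterlim_real_sequentially])
    then show "((\<lambda>n. 3 ^ (d + 1) / real (n div (d + 1))) \<longlongrightarrow> 0) (even_binomial_filter d)"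
      by (rule tendsto_mono[OF filter_le])
  qed auto
qed

end
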